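(* Let $\mathcal{H}$ be a $k$-uniform hypergraph on $n$ vertices with $m>2$ hyperedges, and let $I(\mathcal{H})=(x_{i_1}\cdots x_{i_k}\mid \{i_1,\ldots,i_k\}\in E(\mathcal{H}))$ denote its edge ideal. Suppose that at least one of the following conditions holds: (a) for every hyperedge $e\in E(\mathcal{H})$ there exists a vertex $v_e\in e$ such that $v_e\notin e'$ for all other hyperedges $e'\in E(\mathcal{H})\setminus\{e\}$; (b) $k=n-1$, i.e., each hyperedge has cardinality $n-1$. Then the lcm-lattice $\mathcal{L}(I(\mathcal{H}))$ is modular.
   Context: A $k$-uniform hypergraph $\mathcal{H}=(V,E)$ consists of a vertex set $V=\{1,\dots,n\}$ and a set $E=E(\mathcal{H})$ of $k$-element subsets of $V$ (the hyperedges). Its edge ideal $I(\mathcal{H})$ is the ideal of $S=\mathbb{K}[x_1,\dots,x_n]$ ($\mathbb{K}$ a field) generated by the square-free monomials $x_{i_1}\cdots x_{i_k}$ for $\{i_1,\dots,i_k\}\in E$. The lcm-lattice $\mathcal{L}(I)$ of a monomial ideal $I$ is the set of all least common multiples of subsets of the set of minimal monomial generators of $I$, partially ordered by divisibility; the empty subset contributes the minimal element $\hat 0=1$, and the maximal element $\hat 1$ is the lcm of all generators. Meets and joins are taken in this poset. A lattice $\mathcal{L}$ is modular if for all $x,y,z\in\mathcal{L}$ with $x\le z$ one has $x\vee(y\wedge z)=(x\vee y)\wedge z$. *)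

theory Defs
  imports
    "HOL-Library.Poly_Mapping"
    "HOL-Algebra.Ideal"
    "HOL-Algebra.Lattice"
    "HOL-Algebra.Divisibility"
begin

text \<open>
  A hypergraph on the vertex set \<open>{1..n}\<close> is given by its set of hyperedges.
\<close>

definition uniform_hypergraph :: "nat \<Rightarrow> nat \<Rightarrow> nat set set \<Rightarrow> bool" where
  "uniform_hypergraph k n E \<longleftrightarrow> (\<forall>e\<in>E. e \<subseteq> {1..n} \<and> card e = k)"

text \<open>
  A polynomial is a finitely supported map from exponent vectors (finitely supported maps
  from indices to exponents) to coefficients; multiplication on \<^typ>\<open>(nat \<Rightarrow>\<^sub>0 nat) \<Rightarrow>\<^sub>0 'a::field\<close>
  is the convolution product. The ring \<open>K[x\<^sub>1, \<dots>, x\<^sub>n]\<close> consists of those polynomials in which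
  no variable with index outside \<open>{1..n}\<close> occurs.
\<close>

type_synonym 'a mpol = "(nat \<Rightarrow>\<^sub>0 nat) \<Rightarrow>\<^sub>0 'a"

definition mpol_ring :: "nat \<Rightarrow> 'a::field mpol ring" where
  "mpol_ring n =
     \<lparr>carrier = {p. \<forall>a\<in>Poly_Mapping.keys p. Poly_Mapping.keys a \<subseteq> {1..n}},
      monoid.mult = (*), one = 1, zero = 0, add = (+)\<rparr>"

definition mvar :: "nat \<Rightarrow> 'a::field mpol" where
  "mvar i = Poly_Mapping.single (Poly_Mapping.single i 1) 1"

definition monomials :: "nat \<Rightarrow> 'a::field mpol set" where
  "monomials n = {Poly_Mapping.single a 1 | a. Poly_Mapping.keys a \<subseteq> {1..n}}"

definition edge_ideal :: "nat \<Rightarrow> nat set set \<Rightarrow> 'a::field mpol set" where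
  "edge_ideal n E = Idl\<^bsub>mpol_ring n\<^esub> ((\<lambda>e. \<Prod>i\<in>e. mvar i) ` E)"

definition is_minimal_monomial_gens :: "nat \<Rightarrow> 'a::field mpol set \<Rightarrow> 'a mpol set \<Rightarrow> bool" where
  "is_minimal_monomial_gens n I G \<longleftrightarrow>
     G \<subseteq> monomials n \<and> Idl\<^bsub>mpol_ring n\<^esub> G = I \<and> (\<forall>G'. G' \<subset> G \<longrightarrow> Idl\<^bsub>mpol_ring n\<^esub> G' \<noteq> I)"

text \<open>
  Every monomial ideal has exactly one generating set of monomials that is minimal with respect
  to inclusion; uniqueness is lemma \<open>is_minimal_monomial_gens_unique\<close> below.
\<close>

definition minimal_monomial_gens :: "nat \<Rightarrow> 'a::field mpol set \<Rightarrow> 'a mpol set" where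
  "minimal_monomial_gens n I = (THE G. is_minimal_monomial_gens n I G)"

text \<open>
  A least common multiple of a set is a least upper bound of it for divisibility in the ring.
  It is determined only up to units, and restricting to \<^const>\<open>monomials\<close> (which have
  coefficient 1) picks one representative.
\<close>

definition is_lcm_of :: "('a, 'b) monoid_scheme \<Rightarrow> 'a \<Rightarrow> 'a set \<Rightarrow> bool" where
  "is_lcm_of R l A \<longleftrightarrow> least (division_rel R) l (Upper (division_rel R) A)"

definition lcm_lattice :: "nat \<Rightarrow> 'a::field mpol set \<Rightarrow> 'a mpol gorder" where
  "lcm_lattice n I =
     \<lparr>carrier = {l \<in> monomials n. \<exists>A \<subseteq> minimal_monomial_gens n I. is_lcm_of (mpol_ring n) l A},
      eq = (=), le = (divides\<^bsub>mpol_ring n\<^esub>)\<rparr>"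

locale modular_lattice = Lattice.lattice +
  assumes modular:
    "\<lbrakk>x \<in> carrier L; y \<in> carrier L; z \<in> carrier L; x \<sqsubseteq> z\<rbrakk> \<Longrightarrow> x \<squnion> (y \<sqinter> z) = (x \<squnion> y) \<sqinter> z"

lemma mpol_ring_simps:
  "carrier (mpol_ring n) = {p. \<forall>a\<in>Poly_Mapping.keys p. Poly_Mapping.keys a \<subseteq> {1..n}}"
  "x \<otimes>\<^bsub>mpol_ring n\<^esub> y = x * y" "x \<oplus>\<^bsub>mpol_ring n\<^esub> y = x + y"
  "\<one>\<^bsub>mpol_ring n\<^esub> = 1" "\<zero>\<^bsub>mpol_ring n\<^esub> = 0"
  by (simp_all add: mpol_ring_def)

lemma cring_mpol_ring: "cring (mpol_ring n :: 'a::field mpol ring)"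
proof -
  have plus: "p + q \<in> carrier (mpol_ring n)"
    if "p \<in> carrier (mpol_ring n)" "q \<in> carrier (mpol_ring n)" for p q :: "'a mpol"
    using that Poly_Mapping.keys_add[of p q] unfolding mpol_ring_simps by blast
  have times: "p * q \<in> carrier (mpol_ring n)"
    if p: "p \<in> carrier (mpol_ring n)" and q: "q \<in> carrier (mpol_ring n)" for p q :: "'a mpol"
    unfolding mpol_ring_simps
  proof safe
    fix c i assume c: "c \<in> Poly_Mapping.keys (p * q)" and i: "i \<in> Poly_Mapping.keys c"
    obtain a b where ab: "c = a + b" "a \<in> Poly_Mapping.keys p" "b \<in> Poly_Mapping.keys q"
      using c keys_mult[of p q] by blast
    then have "Poly_Mapping.keys a \<subseteq> {1..n}" "Poly_Mapping.keys b \<subseteq> {1..n}"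
      using p q unfolding mpol_ring_simps by blast+
    then show "i \<in> {1..n}" using i Poly_Mapping.keys_add[of a b] ab(1) by blast
  qed
  have neg: "- p \<in> carrier (mpol_ring n)" if "p \<in> carrier (mpol_ring n)" for p :: "'a mpol"
    using that unfolding mpol_ring_simps by simp
  have one: "1 \<in> carrier (mpol_ring n :: 'a mpol ring)"
    unfolding mpol_ring_simps by (simp flip: single_one)
  have zero: "0 \<in> carrier (mpol_ring n :: 'a mpol ring)"
    unfolding mpol_ring_simps by simp
  show ?thesis
  proof (rule cringI)
    show "abelian_group (mpol_ring n :: 'a mpol ring)"
    proof (rule abelian_groupI)
      fix x :: "'a mpol" assume "x \<in> carrier (mpol_ring n)"
      then show "\<exists>y\<in>carrier (mpol_ring n). y \<oplus>\<^bsub>mpol_ring n\<^esub> x = \<zero>\<^bsub>mpol_ring n\<^esub>"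
        using neg[of x] unfolding mpol_ring_simps(3,5) by (intro bexI[of _ "- x"]) auto
    qed (use plus zero in \<open>simp_all add: mpol_ring_simps(2-) algebra_simps\<close>)
    show "Group.comm_monoid (mpol_ring n :: 'a mpol ring)"
      by unfold_locales
        (use times one in \<open>simp_all add: mpol_ring_simps(2-) algebra_simps\<close>)
  qed (simp add: mpol_ring_simps(2-) algebra_simps)
qed

lemma monomials_subset_carrier: "monomials n \<subseteq> carrier (mpol_ring n)"
  by (auto simp: monomials_def mpol_ring_simps)

lemma monomial_divides_monomial:
  assumes "Poly_Mapping.keys c \<subseteq> {1..n}"
  shows "Poly_Mapping.single b (1::'a::field) divides\<^bsub>mpol_ring n\<^esub> Poly_Mapping.single (b + c) 1"
proof -
  have "Poly_Mapping.single c (1::'a) \<in> carrier (mpol_ring n)"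
    using assms by (simp add: mpol_ring_simps)
  moreover have "Poly_Mapping.single (b + c) (1::'a) =
      Poly_Mapping.single b 1 * Poly_Mapping.single c 1"
    by (simp add: mult_single)
  ultimately show ?thesis unfolding factor_def mpol_ring_simps(2) by blast
qed

lemma monomial_in_Idl_imp_divides:
  fixes M :: "'a::field mpol set"
  assumes M: "M \<subseteq> monomials n" and x: "x \<in> monomials n" "x \<in> Idl\<^bsub>mpol_ring n\<^esub> M"
  shows "\<exists>y\<in>M. y divides\<^bsub>mpol_ring n\<^esub> x"
proof -
  interpret cring "mpol_ring n :: 'a mpol ring" by (rule cring_mpol_ring)
  define J :: "'a mpol set" where
    "J = {p \<in> carrier (mpol_ring n). \<forall>a\<in>Poly_Mapping.keys p.
            \<exists>b c. Poly_Mapping.single b 1 \<in> M \<and> a = b + c}"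
  have "ideal J (mpol_ring n)"
  proof (rule idealI)
    show "ring (mpol_ring n :: 'a mpol ring)" by (rule ring_axioms)
    show "subgroup J (add_monoid (mpol_ring n))"
    proof (rule add.subgroupI)
      show "J \<subseteq> carrier (mpol_ring n)" by (auto simp: J_def)
      have "0 \<in> J" using zero_closed by (simp add: J_def mpol_ring_simps(5))
      then show "J \<noteq> {}" by blast
    next
      fix p assume p: "p \<in> J"
      then have "\<ominus>\<^bsub>mpol_ring n\<^esub> p = - p"
        by (intro minus_equality) (auto simp: J_def mpol_ring_simps)
      then show "\<ominus>\<^bsub>mpol_ring n\<^esub> p \<in> J" using p by (simp add: J_def mpol_ring_simps(1))
    next
      fix p q assume pq: "p \<in> J" "q \<in> J"
      then have "p \<oplus>\<^bsub>mpol_ring n\<^esub> q \<in> carrier (mpol_ring n)" by (simp add: J_def)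
      then show "p \<oplus>\<^bsub>mpol_ring n\<^esub> q \<in> J"
        using pq Poly_Mapping.keys_add[of p q] unfolding J_def mpol_ring_simps(3) by blast
    qed
  next
    have *: "q * p \<in> J" if "p \<in> J" "q \<in> carrier (mpol_ring n)" for p q
    proof -
      have "q * p \<in> carrier (mpol_ring n)"
        using m_closed[of q p] that by (simp add: J_def mpol_ring_simps(2))
      moreover have "\<exists>b c. Poly_Mapping.single b 1 \<in> M \<and> u = b + c"
        if u: "u \<in> Poly_Mapping.keys (q * p)" for u
      proof -
        obtain v w where "u = v + w" "w \<in> Poly_Mapping.keys p"
          using u keys_mult[of q p] by blast
        moreover obtain b c where "Poly_Mapping.single b 1 \<in> M" "w = b + c"
          using \<open>p \<in> J\<close> \<open>w \<in> Poly_Mapping.keys p\<close> by (auto simp: J_def)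
        ultimately have "Poly_Mapping.single b 1 \<in> M \<and> u = b + (v + c)"
          by (simp add: algebra_simps)
        then show ?thesis by blast
      qed
      ultimately show ?thesis by (simp add: J_def)
    qed
    fix p q :: "'a mpol" assume "p \<in> J" "q \<in> carrier (mpol_ring n)"
    then show "q \<otimes>\<^bsub>mpol_ring n\<^esub> p \<in> J" "p \<otimes>\<^bsub>mpol_ring n\<^esub> q \<in> J"
      using *[of p q] by (simp_all add: mpol_ring_simps(2) mult.commute)
  qed
  moreover have "M \<subseteq> J"
  proof
    fix p assume p: "p \<in> M"
    then obtain a where a: "p = Poly_Mapping.single a 1" using M by (auto simp: monomials_def)
    have "p \<in> carrier (mpol_ring n)" using p M monomials_subset_carrier by blast
    moreover have "\<exists>b c. Poly_Mapping.single b 1 \<in> M \<and> a = b + c"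
      using p a by (intro exI[of _ a] exI[of _ 0]) simp
    ultimately show "p \<in> J" by (simp add: J_def a)
  qed
  ultimately have "x \<in> J" using x(2) genideal_minimal by blast
  obtain a where a: "x = Poly_Mapping.single a 1" "Poly_Mapping.keys a \<subseteq> {1..n}"
    using x(1) by (auto simp: monomials_def)
  then obtain b c where bc: "Poly_Mapping.single b 1 \<in> M" "a = b + c"
    using \<open>x \<in> J\<close> by (auto simp: J_def)
  have "Poly_Mapping.keys c \<subseteq> Poly_Mapping.keys a"
    by (auto simp: bc(2) in_keys_iff lookup_add)
  then have "Poly_Mapping.single b (1::'a) divides\<^bsub>mpol_ring n\<^esub> x"
    unfolding a bc(2) using a(2) bc(2) by (intro monomial_divides_monomial) auto
  then show ?thesis using bc(1) by blast
qed

lemma monomial_divides_antisym: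
  assumes "x \<in> monomials n" "y \<in> monomials n"
    and "x divides\<^bsub>mpol_ring n\<^esub> y" "y divides\<^bsub>mpol_ring n\<^esub> x"
  shows "x = (y :: 'a::field mpol)"
proof -
  interpret cring "mpol_ring n :: 'a mpol ring" by (rule cring_mpol_ring)
  have le: "\<exists>c. b = a + c"
    if dvd: "Poly_Mapping.single a (1::'a) divides\<^bsub>mpol_ring n\<^esub> Poly_Mapping.single b 1" for a b
  proof -
    obtain q where "Poly_Mapping.single b (1::'a) = Poly_Mapping.single a 1 * q"
      using dvd by (auto simp: factor_def mpol_ring_simps(2))
    then have "b \<in> Poly_Mapping.keys (Poly_Mapping.single a (1::'a) * q)"
      by (metis keys_single insertI1 one_neq_zero)
    then show ?thesis using keys_mult[of "Poly_Mapping.single a (1::'a)" q] by auto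
  qed
  obtain a b where ab: "x = Poly_Mapping.single a 1" "y = Poly_Mapping.single b 1"
    using assms by (auto simp: monomials_def)
  then obtain c d where cd: "b = a + c" "a = b + d" using assms le by metis
  have "Poly_Mapping.lookup a i = Poly_Mapping.lookup b i" for i
    using arg_cong[OF cd(1), of "\<lambda>f. Poly_Mapping.lookup f i"] arg_cong[OF cd(2), of "\<lambda>f. Poly_Mapping.lookup f i"]
    by (simp add: lookup_add)
  then have "a = b" by (rule poly_mapping_eqI)
  then show ?thesis by (simp add: ab)
qed

lemma is_minimal_monomial_gens_divides_eq:
  fixes G :: "'a::field mpol set"
  assumes G: "is_minimal_monomial_gens n I G" and "g \<in> G" "g' \<in> G" "g' divides\<^bsub>mpol_ring n\<^esub> g"
  shows "g' = g"
proof (rule ccontr)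
  interpret cring "mpol_ring n :: 'a mpol ring" by (rule cring_mpol_ring)
  assume ne: "g' \<noteq> g"
  have GC: "G \<subseteq> carrier (mpol_ring n)" "G - {g} \<subseteq> carrier (mpol_ring n)"
    using G monomials_subset_carrier by (auto simp: is_minimal_monomial_gens_def)
  have id: "ideal (Idl\<^bsub>mpol_ring n\<^esub> (G - {g})) (mpol_ring n)"
    by (rule genideal_ideal[OF GC(2)])
  have "g' \<in> Idl\<^bsub>mpol_ring n\<^esub> (G - {g})" using genideal_self[OF GC(2)] assms ne by blast
  then have "g \<in> Idl\<^bsub>mpol_ring n\<^esub> (G - {g})"
    using assms(4) ideal.I_r_closed[OF id] by (auto simp: factor_def)
  then have "G \<subseteq> Idl\<^bsub>mpol_ring n\<^esub> (G - {g})" using genideal_self[OF GC(2)] by blast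
  then have "Idl\<^bsub>mpol_ring n\<^esub> G \<subseteq> Idl\<^bsub>mpol_ring n\<^esub> (G - {g})"
    using genideal_minimal[OF id] by blast
  moreover have "Idl\<^bsub>mpol_ring n\<^esub> (G - {g}) \<subseteq> Idl\<^bsub>mpol_ring n\<^esub> G"
    using genideal_minimal[OF genideal_ideal[OF GC(1)]] genideal_self[OF GC(1)] by blast
  moreover have "G - {g} \<subset> G" using assms(2) by blast
  ultimately show False using G unfolding is_minimal_monomial_gens_def by blast
qed

lemma is_minimal_monomial_gens_unique:
  fixes G H :: "'a::field mpol set"
  assumes "is_minimal_monomial_gens n I G" "is_minimal_monomial_gens n I H"
  shows "G = H"
proof -
  interpret cring "mpol_ring n :: 'a mpol ring" by (rule cring_mpol_ring)
  have "A \<subseteq> B" if A: "is_minimal_monomial_gens n I A" and B: "is_minimal_monomial_gens n I B"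
    for A B :: "'a mpol set"
  proof
    have mon: "A \<subseteq> monomials n" "B \<subseteq> monomials n"
      and Idl: "Idl\<^bsub>mpol_ring n\<^esub> A = I" "Idl\<^bsub>mpol_ring n\<^esub> B = I"
      using A B by (simp_all add: is_minimal_monomial_gens_def)
    note car = mon[THEN subset_trans[OF _ monomials_subset_carrier]]
    note sub = car[THEN genideal_self, unfolded Idl]
    fix a assume a: "a \<in> A"
    then obtain b where b: "b \<in> B" "b divides\<^bsub>mpol_ring n\<^esub> a"
      using monomial_in_Idl_imp_divides[OF mon(2), of a] mon(1) sub(1) Idl(2) by blast
    then obtain a' where a': "a' \<in> A" "a' divides\<^bsub>mpol_ring n\<^esub> b"
      using monomial_in_Idl_imp_divides[OF mon(1), of b] mon(2) sub(2) Idl(1) by blast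
    have "a' \<in> carrier (mpol_ring n)" using a'(1) car(1) by blast
    then have "a' divides\<^bsub>mpol_ring n\<^esub> a" by (rule divides_trans[OF a'(2) b(2)])
    then have "a' = a" by (rule is_minimal_monomial_gens_divides_eq[OF A a a'(1)])
    then have "a = b" using monomial_divides_antisym[of a n b] a a' b mon by blast
    then show "a \<in> B" using b(1) by simp
  qed
  then show ?thesis using assms by blast
qed

end

theory Submission
  imports Defs
begin

text \<open>
  Square-free monomials correspond to finite sets of vertices, with divisibility becoming
  inclusion and least common multiple becoming union. The edges of a uniform hypergraph form an
  antichain, so their monomials are the minimal generators of the edge ideal, and the lcm-lattice
  is the poset of all unions \<open>\<Union>F\<close> with \<open>F \<subseteq> E\<close> (lemma \<open>lcm_lattice_edge_ideal\<close>).

  If every edge has a private vertex, the union \<open>\<Union>F\<close> determines \<open>F\<close>, since \<open>e \<in> F\<close> exactly when the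
  private vertex of \<open>e\<close> lies in \<open>\<Union>F\<close>. The lattice is then the Boolean lattice of all subsets
  of \<open>E\<close>. If the edges have \<open>n - 1\<close> elements, any two different ones cover all vertices, so the only unions
  are \<open>{}\<close>, the edges and \<open>{1..n}\<close>. In such a lattice of height two, a pair \<open>x \<le> z\<close> has \<open>x = z\<close>,
  \<open>x\<close> at the bottom or \<open>z\<close> at the top, and the modular law is trivial in each of these cases.
\<close>

section \<open>Square-free monomials\<close>

definition sqfree_exponent :: "nat set \<Rightarrow> (nat \<Rightarrow>\<^sub>0 nat)" where
  "sqfree_exponent A = (\<Sum>i\<in>A. Poly_Mapping.single i 1)"

definition sqfree_monomial :: "nat set \<Rightarrow> 'a::field mpol" where
  "sqfree_monomial A = Poly_Mapping.single (sqfree_exponent A) 1"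

lemma lookup_sqfree_exponent:
  assumes "finite A"
  shows "Poly_Mapping.lookup (sqfree_exponent A) i = (if i \<in> A then 1 else 0)"
  using assms unfolding sqfree_exponent_def
  by (simp add: lookup_sum lookup_single when_def sum.delta)

lemma keys_sqfree_exponent: "finite A \<Longrightarrow> Poly_Mapping.keys (sqfree_exponent A) = A"
  by (auto simp: in_keys_iff lookup_sqfree_exponent split: if_splits)

lemma prod_mvar_eq_sqfree_monomial:
  assumes "finite A"
  shows "(\<Prod>i\<in>A. mvar i) = (sqfree_monomial A :: 'a::field mpol)"
  using assms
  by (induction A rule: finite_induct)
    (simp_all add: sqfree_monomial_def sqfree_exponent_def mvar_def mult_single)

lemma sqfree_monomial_in_monomials:
  "A \<subseteq> {1..n} \<Longrightarrow> (sqfree_monomial A :: 'a::field mpol) \<in> monomials n"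
  using keys_sqfree_exponent[of A] finite_subset[of A "{1..n}"]
  by (auto simp: monomials_def sqfree_monomial_def)

lemma sum_single_lookup_keys:
  "(\<Sum>b\<in>Poly_Mapping.keys p. Poly_Mapping.single b (Poly_Mapping.lookup p b)) = p"
  by (rule poly_mapping_eqI)
    (auto simp: lookup_sum lookup_single when_def in_keys_iff sum.delta)

text \<open>
  The quotient is obtained term by term. Here \<open>p\<close> is an arbitrary polynomial, because least
  common multiples are taken among all polynomials, not only among monomials.
\<close>

lemma sqfree_monomial_divides_iff:
  fixes p :: "'a::field mpol"
  assumes A: "A \<subseteq> {1..n}" and p: "p \<in> carrier (mpol_ring n)"
  shows "sqfree_monomial A divides\<^bsub>mpol_ring n\<^esub> p \<longleftrightarrow> (\<forall>b\<in>Poly_Mapping.keys p. A \<subseteq> Poly_Mapping.keys b)"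
proof
  have fin: "finite A" using A finite_subset by blast
  let ?a = "sqfree_exponent A"
  {
    assume "sqfree_monomial A divides\<^bsub>mpol_ring n\<^esub> p"
    then obtain q where q: "p = sqfree_monomial A * q"
      by (auto simp: factor_def mpol_ring_simps)
    show "\<forall>b\<in>Poly_Mapping.keys p. A \<subseteq> Poly_Mapping.keys b"
    proof
      fix b assume "b \<in> Poly_Mapping.keys p"
      then obtain c where "b = ?a + c"
        using keys_mult[of "sqfree_monomial A" q] unfolding q by (auto simp: sqfree_monomial_def)
      then show "A \<subseteq> Poly_Mapping.keys b"
        by (auto simp: in_keys_iff lookup_add lookup_sqfree_exponent[OF fin])
    qed
  next
    assume *: "\<forall>b\<in>Poly_Mapping.keys p. A \<subseteq> Poly_Mapping.keys b"
    define q where "q = (\<Sum>b\<in>Poly_Mapping.keys p. Poly_Mapping.single (b - ?a) (Poly_Mapping.lookup p b))"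
    have split: "?a + (b - ?a) = b" if "b \<in> Poly_Mapping.keys p" for b
    proof (rule poly_mapping_eqI)
      fix i
      have "i \<in> A \<Longrightarrow> Poly_Mapping.lookup b i \<noteq> 0"
        using * that in_keys_iff[of i b] by blast
      then show "Poly_Mapping.lookup (?a + (b - ?a)) i = Poly_Mapping.lookup b i"
        by (auto simp: lookup_add lookup_minus lookup_sqfree_exponent[OF fin])
    qed
    have "sqfree_monomial A * q =
        (\<Sum>b\<in>Poly_Mapping.keys p. Poly_Mapping.single (?a + (b - ?a)) (Poly_Mapping.lookup p b))"
      unfolding q_def sqfree_monomial_def by (simp add: sum_distrib_left mult_single)
    also have "\<dots> = p"
      using split sum_single_lookup_keys[of p] by simp
    finally have eq: "p = sqfree_monomial A * q" by simp
    have "q \<in> carrier (mpol_ring n)"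
      unfolding mpol_ring_simps
    proof (intro CollectI ballI subsetI)
      fix c i assume "c \<in> Poly_Mapping.keys q" and i: "i \<in> Poly_Mapping.keys c"
      then obtain b where b: "b \<in> Poly_Mapping.keys p" "c = b - ?a"
        unfolding q_def using keys_sum by (fastforce split: if_splits)
      then have "i \<in> Poly_Mapping.keys b" using i by (auto simp: in_keys_iff lookup_minus)
      then show "i \<in> {1..n}" using p b(1) unfolding mpol_ring_simps by blast
    qed
    then show "sqfree_monomial A divides\<^bsub>mpol_ring n\<^esub> p"
      unfolding factor_def mpol_ring_simps(2) using eq by blast
  }
qed

lemma sqfree_monomial_divides_sqfree_monomial_iff:
  assumes "A \<subseteq> {1..n}" "B \<subseteq> {1..n}"
  shows "sqfree_monomial A divides\<^bsub>mpol_ring n\<^esub> (sqfree_monomial B :: 'a::field mpol) \<longleftrightarrow> A \<subseteq> B"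
proof -
  have "(sqfree_monomial B :: 'a mpol) \<in> carrier (mpol_ring n)"
    using sqfree_monomial_in_monomials[OF assms(2)] monomials_subset_carrier by blast
  moreover have "Poly_Mapping.keys (sqfree_monomial B :: 'a mpol) = {sqfree_exponent B}"
    by (simp add: sqfree_monomial_def)
  ultimately show ?thesis
    using sqfree_monomial_divides_iff[OF assms(1), of "sqfree_monomial B :: 'a mpol"]
      keys_sqfree_exponent[of B] finite_subset[OF assms(2)]
    by auto
qed

section \<open>The lcm-lattice of an edge ideal\<close>

text \<open>
  By \<open>sqfree_monomial_divides_iff\<close>, being divisible by the monomial of \<open>\<Union>F\<close> and by the
  monomials of all members of \<open>F\<close> are the same condition on a polynomial. This includes \<open>F = {}\<close>,
  whose least common multiple is \<open>1\<close>.
\<close>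

lemma is_lcm_of_sqfree_monomials_iff:
  fixes l :: "'a::field mpol"
  assumes F: "\<And>e. e \<in> F \<Longrightarrow> e \<subseteq> {1..n}" and l: "l \<in> monomials n"
  shows "is_lcm_of (mpol_ring n) l (sqfree_monomial ` F) \<longleftrightarrow> l = sqfree_monomial (\<Union>F)"
proof -
  let ?R = "mpol_ring n :: 'a mpol ring"
  let ?U = "Upper (division_rel ?R) (sqfree_monomial ` F)"
  have UF: "\<Union>F \<subseteq> {1..n}" using F by blast
  have car: "sqfree_monomial e \<in> carrier ?R" if "e \<subseteq> {1..n}" for e
    using sqfree_monomial_in_monomials[OF that] monomials_subset_carrier by blast
  have U: "p \<in> ?U \<longleftrightarrow> p \<in> carrier ?R \<and> sqfree_monomial (\<Union>F) divides\<^bsub>?R\<^esub> p" for p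
  proof (cases "p \<in> carrier ?R")
    case True
    have "p \<in> ?U \<longleftrightarrow> (\<forall>e\<in>F. sqfree_monomial e divides\<^bsub>?R\<^esub> p)"
      using True car F by (auto simp: Upper_def)
    also have "\<dots> \<longleftrightarrow> (\<forall>b\<in>Poly_Mapping.keys p. \<Union>F \<subseteq> Poly_Mapping.keys b)"
      using sqfree_monomial_divides_iff[OF F True] by blast
    finally show ?thesis using True sqfree_monomial_divides_iff[OF UF True] by simp
  qed (simp add: Upper_def)
  have self: "sqfree_monomial (\<Union>F) \<in> ?U"
    using U car[OF UF] sqfree_monomial_divides_sqfree_monomial_iff[OF UF UF] by simp
  show ?thesis
  proof
    assume "is_lcm_of ?R l (sqfree_monomial ` F)"
    then have "l \<in> ?U" and "l divides\<^bsub>?R\<^esub> sqfree_monomial (\<Union>F)"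
      using self by (auto simp: is_lcm_of_def least_def)
    then show "l = sqfree_monomial (\<Union>F)"
      using U monomial_divides_antisym[OF l sqfree_monomial_in_monomials[OF UF]] by blast
  next
    assume "l = sqfree_monomial (\<Union>F)"
    then show "is_lcm_of ?R l (sqfree_monomial ` F)"
      using self U by (auto simp: is_lcm_of_def least_def)
  qed
qed

text \<open>
  A monomial in a monomial ideal is divisible by one of the generators, so in an antichain no
  generator can be left out.
\<close>

lemma minimal_monomial_gens_edge_ideal:
  assumes sub: "\<And>e. e \<in> E \<Longrightarrow> e \<subseteq> {1..n}"
    and antichain: "\<And>e e'. e \<in> E \<Longrightarrow> e' \<in> E \<Longrightarrow> e \<subseteq> e' \<Longrightarrow> e = e'"
  shows "minimal_monomial_gens n (edge_ideal n E :: 'a::field mpol set) = sqfree_monomial ` E"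
proof -
  interpret cring "mpol_ring n :: 'a mpol ring" by (rule cring_mpol_ring)
  let ?G = "sqfree_monomial ` E :: 'a mpol set"
  have mon: "?G \<subseteq> monomials n" using sub sqfree_monomial_in_monomials by blast
  have "finite e" if "e \<in> E" for e using sub[OF that] finite_subset by blast
  then have "(\<lambda>e. \<Prod>i\<in>e. mvar i) ` E = ?G"
    using prod_mvar_eq_sqfree_monomial by (intro image_cong) auto
  then have I: "Idl\<^bsub>mpol_ring n\<^esub> ?G = edge_ideal n E" by (simp add: edge_ideal_def)
  have "Idl\<^bsub>mpol_ring n\<^esub> G' \<noteq> edge_ideal n E" if G': "G' \<subset> ?G" for G'
  proof
    assume eq: "Idl\<^bsub>mpol_ring n\<^esub> G' = edge_ideal n E"
    obtain e where e: "e \<in> E" "sqfree_monomial e \<notin> G'" using G' by blast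
    have "?G \<subseteq> Idl\<^bsub>mpol_ring n\<^esub> ?G"
      using genideal_self mon monomials_subset_carrier by blast
    then have "sqfree_monomial e \<in> Idl\<^bsub>mpol_ring n\<^esub> G'" using e(1) eq I by blast
    then obtain y where y: "y \<in> G'" "y divides\<^bsub>mpol_ring n\<^esub> sqfree_monomial e"
      using monomial_in_Idl_imp_divides[of G' n "sqfree_monomial e"] G' mon e(1) by blast
    then obtain e' where e': "e' \<in> E" "y = sqfree_monomial e'" using G' by blast
    then have "e' \<subseteq> e"
      using y(2) sqfree_monomial_divides_sqfree_monomial_iff sub e(1) by blast
    then show False using antichain e' e y(1) by blast
  qed
  then have min: "is_minimal_monomial_gens n (edge_ideal n E) ?G"
    using mon I by (simp add: is_minimal_monomial_gens_def)
  show ?thesis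
    unfolding minimal_monomial_gens_def
    using min is_minimal_monomial_gens_unique[OF _ min] by (rule the_equality)
qed

lemma lcm_lattice_edge_ideal:
  assumes sub: "\<And>e. e \<in> E \<Longrightarrow> e \<subseteq> {1..n}"
    and antichain: "\<And>e e'. e \<in> E \<Longrightarrow> e' \<in> E \<Longrightarrow> e \<subseteq> e' \<Longrightarrow> e = e'"
  shows "lcm_lattice n (edge_ideal n E :: 'a::field mpol set) =
    \<lparr>carrier = (\<lambda>F. sqfree_monomial (\<Union>F)) ` Pow E, eq = (=), le = (divides\<^bsub>mpol_ring n\<^esub>)\<rparr>"
proof -
  have mon: "sqfree_monomial (\<Union>F) \<in> (monomials n :: 'a mpol set)" if "F \<subseteq> E" for F
    using that sub by (intro sqfree_monomial_in_monomials) blast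
  have lcm: "is_lcm_of (mpol_ring n) l (sqfree_monomial ` F) \<longleftrightarrow> l = sqfree_monomial (\<Union>F)"
    if "F \<subseteq> E" "l \<in> monomials n" for F and l :: "'a mpol"
    using that sub by (intro is_lcm_of_sqfree_monomials_iff) blast+
  have "{l \<in> monomials n. \<exists>A \<subseteq> sqfree_monomial ` E. is_lcm_of (mpol_ring n) l A} =
      (\<lambda>F. sqfree_monomial (\<Union>F) :: 'a mpol) ` Pow E"
    using mon lcm by (auto simp: subset_image_iff)
  then show ?thesis
    by (simp add: lcm_lattice_def minimal_monomial_gens_edge_ideal[OF assms])
qed

section \<open>Modularity\<close>

text \<open>
  Joins and meets of \<open>L\<close> are chosen by \<open>SOME\<close>; antisymmetry identifies them with the images
  of explicitly given operations on a family of sets that represents \<open>L\<close>.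
\<close>

lemma modular_lattice_of_set_representation:
  fixes L (structure) and f :: "'s set \<Rightarrow> 'a"
  assumes eq: "eq L = (=)" and car: "carrier L = f ` U"
    and le: "\<And>A B. A \<in> U \<Longrightarrow> B \<in> U \<Longrightarrow> f A \<sqsubseteq> f B \<longleftrightarrow> A \<subseteq> B"
    and J: "\<And>A B. A \<in> U \<Longrightarrow> B \<in> U \<Longrightarrow> J A B \<in> U \<and> A \<subseteq> J A B \<and> B \<subseteq> J A B"
    and J_least: "\<And>A B C. A \<in> U \<Longrightarrow> B \<in> U \<Longrightarrow> C \<in> U \<Longrightarrow> A \<subseteq> C \<Longrightarrow> B \<subseteq> C \<Longrightarrow> J A B \<subseteq> C"
    and M: "\<And>A B. A \<in> U \<Longrightarrow> B \<in> U \<Longrightarrow> M A B \<in> U \<and> M A B \<subseteq> A \<and> M A B \<subseteq> B"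
    and M_greatest: "\<And>A B C. A \<in> U \<Longrightarrow> B \<in> U \<Longrightarrow> C \<in> U \<Longrightarrow> C \<subseteq> A \<Longrightarrow> C \<subseteq> B \<Longrightarrow> C \<subseteq> M A B"
    and modular: "\<And>A B C. A \<in> U \<Longrightarrow> B \<in> U \<Longrightarrow> C \<in> U \<Longrightarrow> A \<subseteq> C \<Longrightarrow> J A (M B C) = M (J A B) C"
  shows "modular_lattice L"
proof -
  have ord: "partial_order L"
    by unfold_locales (auto simp: eq car le)
  interpret partial_order L by (rule ord)
  have lub: "least L (f (J A B)) (Upper L {f A, f B})" if "A \<in> U" "B \<in> U" for A B
    using that J[of A B] J_least[of A B] by (auto simp: least_def Upper_def car le)
  have glb: "greatest L (f (M A B)) (Lower L {f A, f B})" if "A \<in> U" "B \<in> U" for A B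
    using that M[of A B] M_greatest[of A B] by (auto simp: greatest_def Lower_def car le)
  have lat: "Lattice.lattice L"
    by unfold_locales (use lub glb in \<open>unfold car, blast+\<close>)
  interpret lattice L by (rule lat)
  have join: "f A \<squnion> f B = f (J A B)" if "A \<in> U" "B \<in> U" for A B
    using that least_unique[OF sup_of_two_least lub] by (simp add: car join_def)
  have meet: "f A \<sqinter> f B = f (M A B)" if "A \<in> U" "B \<in> U" for A B
    using that greatest_unique[OF inf_of_two_greatest glb] by (simp add: car meet_def)
  show ?thesis
    by unfold_locales (use J M in \<open>auto simp: car join meet le modular\<close>)
qed

lemma Union_subset_Union_iff_if_private_vertices:
  assumes priv: "\<forall>e\<in>E. \<exists>v\<in>e. \<forall>e'\<in>E - {e}. v \<notin> e'" and "F \<subseteq> E" "G \<subseteq> E"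
  shows "\<Union>F \<subseteq> \<Union>G \<longleftrightarrow> F \<subseteq> G"
proof
  assume sub: "\<Union>F \<subseteq> \<Union>G"
  show "F \<subseteq> G"
  proof
    fix e assume e: "e \<in> F"
    then obtain v where v: "v \<in> e" "\<forall>e'\<in>E - {e}. v \<notin> e'" using priv assms(2) by blast
    then obtain e' where "e' \<in> G" "v \<in> e'" using sub e by blast
    then show "e \<in> G" using v(2) assms(3) by blast
  qed
qed blast

lemma Un_eq_if_card_Suc:
  assumes "finite V" "A \<subseteq> V" "B \<subseteq> V" "card V = Suc (card A)" "card B = card A" "A \<noteq> B"
  shows "A \<union> B = V"
proof (rule card_seteq[OF assms(1)])
  have fin: "finite A" "finite B" using assms finite_subset by blast+
  then have "\<not> B \<subseteq> A" using card_subset_eq[of A B] assms by auto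
  then have "A \<subset> A \<union> B" by blast
  then show "card V \<le> card (A \<union> B)" using psubset_card_mono[of "A \<union> B" A] fin assms(4) by simp
qed (use assms in blast)

lemma Union_image_Pow_if_pairwise_cover:
  assumes "\<And>e e'. e \<in> E \<Longrightarrow> e' \<in> E \<Longrightarrow> e \<noteq> e' \<Longrightarrow> e \<union> e' = V"
    and "\<Union>E \<subseteq> V" and "a \<in> E" "b \<in> E" "a \<noteq> b"
  shows "Union ` Pow E = insert {} (insert V E)"
proof
  show "Union ` Pow E \<subseteq> insert {} (insert V E)"
  proof
    fix A assume "A \<in> Union ` Pow E"
    then obtain F where F: "F \<subseteq> E" "A = \<Union>F" by blast
    show "A \<in> insert {} (insert V E)"
    proof (cases "\<exists>e\<in>F. \<exists>e'\<in>F. e \<noteq> e'")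
      case True
      then obtain e e' where "e \<in> F" "e' \<in> F" "e \<noteq> e'" by blast
      then have "V \<subseteq> A" using assms(1)[of e e'] F by blast
      then show ?thesis using F assms(2) by blast
    next
      case False
      then consider "F = {}" | e where "F = {e}" by blast
      then show ?thesis using F by cases simp_all
    qed
  qed
  have "V = \<Union>{a, b}" using assms(1)[OF assms(3-5)] by simp
  then have "V \<in> Union ` Pow E" using assms(3,4) by blast
  moreover have "{} \<in> Union ` Pow E" by (rule image_eqI[of _ _ "{}"]) auto
  moreover have "e \<in> Union ` Pow E" if "e \<in> E" for e
    using that by (intro image_eqI[of _ _ "{e}"]) auto
  ultimately show "insert {} (insert V E) \<subseteq> Union ` Pow E" by blast
qed

text \<open>
  The family is a lattice of height at most two under inclusion: the join of incomparable members is \<open>V\<close> and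
  their meet is \<open>{}\<close>, even if they intersect.
\<close>

lemma modular_lattice_of_antichain_with_bounds:
  fixes L (structure) and f :: "'s set \<Rightarrow> 'a"
  assumes eq: "eq L = (=)" and car: "carrier L = f ` insert {} (insert V E)"
    and le: "\<And>A B. A \<in> insert {} (insert V E) \<Longrightarrow> B \<in> insert {} (insert V E) \<Longrightarrow>
      f A \<sqsubseteq> f B \<longleftrightarrow> A \<subseteq> B"
    and sub: "\<Union>E \<subseteq> V" and antichain: "\<And>e e'. e \<in> E \<Longrightarrow> e' \<in> E \<Longrightarrow> e \<subseteq> e' \<Longrightarrow> e = e'"
  shows "modular_lattice L"
proof -
  let ?U = "insert {} (insert V E)"
  define J where "J A B = (if A \<subseteq> B then B else if B \<subseteq> A then A else V)" for A B
  define M where "M A B = (if A \<subseteq> B then A else if B \<subseteq> A then B else {})" for A B :: "'s set"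
  have bound: "A \<subseteq> V" if "A \<in> ?U" for A using that sub by blast
  have comparable: "A = C \<or> A = {} \<or> C = V" if "A \<in> ?U" "C \<in> ?U" "A \<subseteq> C" for A C
    using that antichain bound[of A] bound[of C] by blast
  have J: "J A B \<in> ?U \<and> A \<subseteq> J A B \<and> B \<subseteq> J A B" if "A \<in> ?U" "B \<in> ?U" for A B
    using that bound[of A] bound[of B] unfolding J_def by (simp split: if_splits)
  have M: "M A B \<in> ?U \<and> M A B \<subseteq> A \<and> M A B \<subseteq> B" if "A \<in> ?U" "B \<in> ?U" for A B
    using that unfolding M_def by (simp split: if_splits)
  have J_least: "J A B \<subseteq> C" if "A \<in> ?U" "B \<in> ?U" "C \<in> ?U" "A \<subseteq> C" "B \<subseteq> C" for A B C
    using comparable[of A C] comparable[of B C] that unfolding J_def by auto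
  have M_greatest: "C \<subseteq> M A B" if "A \<in> ?U" "B \<in> ?U" "C \<in> ?U" "C \<subseteq> A" "C \<subseteq> B" for A B C
    using comparable[of C A] comparable[of C B] bound[of A] bound[of B] that
    unfolding M_def by auto
  have modular: "J A (M B C) = M (J A B) C"
    if "A \<in> ?U" "B \<in> ?U" "C \<in> ?U" "A \<subseteq> C" for A B C
    using comparable[of A C] bound[of A] bound[of B] that unfolding J_def M_def by auto
  show ?thesis
    by (rule modular_lattice_of_set_representation
        [where L = L and f = f and U = ?U and J = J and M = M, OF eq car le J J_least M M_greatest modular])
qed

theorem theorem3p8:
  fixes n k m :: nat and E :: "nat set set"
  assumes "uniform_hypergraph k n E"
    and "card E = m" and "m > 2"
    and "(\<forall>e\<in>E. \<exists>v\<in>e. \<forall>e'\<in>E - {e}. v \<notin> e') \<or> k + 1 = n"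
  shows "modular_lattice (lcm_lattice n (edge_ideal n E :: 'a::field mpol set))"
proof -
  have sub: "e \<subseteq> {1..n}" and card: "card e = k" if "e \<in> E" for e
    using assms(1) that by (auto simp: uniform_hypergraph_def)
  have antichain: "e = e'" if "e \<in> E" "e' \<in> E" "e \<subseteq> e'" for e e'
    using card_subset_eq[of e' e] that card sub finite_subset[OF sub] by auto
  note L = lcm_lattice_edge_ideal[OF sub antichain]
  show ?thesis
    using assms(4)
  proof
    assume priv: "\<forall>e\<in>E. \<exists>v\<in>e. \<forall>e'\<in>E - {e}. v \<notin> e'"
    have le: "sqfree_monomial (\<Union>F) divides\<^bsub>mpol_ring n\<^esub> (sqfree_monomial (\<Union>G) :: 'a mpol) \<longleftrightarrow> F \<subseteq> G"
      if "F \<in> Pow E" "G \<in> Pow E" for F G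
    proof -
      have "\<Union>F \<subseteq> {1..n}" "\<Union>G \<subseteq> {1..n}" using that sub by blast+
      then show ?thesis
        using Union_subset_Union_iff_if_private_vertices[OF priv] that
        by (simp add: sqfree_monomial_divides_sqfree_monomial_iff)
    qed
    show ?thesis
      by (rule modular_lattice_of_set_representation
          [where f = "\<lambda>F. sqfree_monomial (\<Union>F)" and U = "Pow E" and J = "(\<union>)" and M = "(\<inter>)"])
        (use le in \<open>auto simp: L\<close>)
  next
    assume n: "k + 1 = n"
    have cover: "e \<union> e' = {1..n}" if "e \<in> E" "e' \<in> E" "e \<noteq> e'" for e e'
      using that sub card n by (intro Un_eq_if_card_Suc) auto
    have "finite E" "\<not> card E \<le> Suc 0" using assms(2,3) card.infinite by fastforce+
    then obtain a b where ab: "a \<in> E" "b \<in> E" "a \<noteq> b"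
      using card_le_Suc0_iff_eq by blast
    have UE: "\<Union>E \<subseteq> {1..n}" using sub by blast
    show ?thesis
    proof (rule modular_lattice_of_antichain_with_bounds
        [where f = sqfree_monomial and V = "{1..n}" and E = E])
      have "carrier (lcm_lattice n (edge_ideal n E :: 'a mpol set)) = sqfree_monomial ` Union ` Pow E"
        by (simp add: L image_image)
      also have "Union ` Pow E = insert {} (insert {1..n} E)"
        by (rule Union_image_Pow_if_pairwise_cover[OF cover UE ab])
      finally show "carrier (lcm_lattice n (edge_ideal n E :: 'a mpol set)) =
          sqfree_monomial ` insert {} (insert {1..n} E)" .
      fix A B assume "A \<in> insert {} (insert {1..n} E)" "B \<in> insert {} (insert {1..n} E)"
      then have "A \<subseteq> {1..n}" "B \<subseteq> {1..n}" using sub by blast+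
      then show "sqfree_monomial A \<sqsubseteq>\<^bsub>lcm_lattice n (edge_ideal n E)\<^esub> (sqfree_monomial B :: 'a mpol) \<longleftrightarrow> A \<subseteq> B"
        using sqfree_monomial_divides_sqfree_monomial_iff by (simp add: L)
    qed (use UE antichain in \<open>auto simp: L\<close>)
  qed
qed

end
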